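(* Suppose that $E$ is a finite-dimensional Banach space. Then $K_G(E,E^* )=K_G(E,E)=\rho(E,E)$.
   Context: All Banach spaces are real. $E\check\otimes F$ and $E\hat\otimes F$ denote the injective and projective tensor products. For $E$ finite-dimensional and $F$ a Banach space, $$K_G(E,F)=\sup\{\|A\otimes\mathrm{id}_F\|_{E\check\otimes F\to E^*\hat\otimes F}:\ A:E\to E^*\text{ linear},\ \|A\|_{E\to E^*}\le1\},$$ $$\rho(E,F)=\|\mathrm{id}_E\otimes\mathrm{id}_F\|_{E\check\otimes F\to E\hat\otimes F}.$$ *)

theory Defs
  imports "HOL-Analysis.Analysis" "HOL-Analysis.Finite_Function_Topology"
begin

section \<open>The algebraic tensor product\<close>

text \<open>The tensor product is the free real vector space on the pairs (the finitely supported
  functions), modulo the span of the bilinearity relations.\<close>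

type_synonym 'p free = "'p \<Rightarrow>\<^sub>0 real"

definition free_pair :: "'a \<Rightarrow> 'b \<Rightarrow> ('a \<times> 'b) free" where
  "free_pair x y = Poly_Mapping.single (x, y) 1"

definition tensor_relations :: "('a::real_vector \<times> 'b::real_vector) free set" where
  "tensor_relations =
     {free_pair (x + x') y - free_pair x y - free_pair x' y | x x' y. True} \<union>
     {free_pair x (y + y') - free_pair x y - free_pair x y' | x y y'. True} \<union>
     {free_pair (c *\<^sub>R x) y - c *\<^sub>R free_pair x y | c x y. True} \<union>
     {free_pair x (c *\<^sub>R y) - c *\<^sub>R free_pair x y | c x y. True}"

definition tensor_eq ::
  "('a::real_vector \<times> 'b::real_vector) free \<Rightarrow> ('a \<times> 'b) free \<Rightarrow> bool" where
  "tensor_eq u v \<longleftrightarrow> u - v \<in> span tensor_relations"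

quotient_type (overloaded) ('a, 'b) tensor =
  "('a::real_vector \<times> 'b::real_vector) free" / tensor_eq
proof (rule equivpI)
  show "reflp tensor_eq"
    by (simp add: reflp_def tensor_eq_def span_zero)
  show "symp tensor_eq"
    unfolding symp_def tensor_eq_def by (metis minus_diff_eq span_neg)
  show "transp tensor_eq"
    unfolding transp_def tensor_eq_def
    by (metis (no_types, lifting) add_diff_eq diff_add_cancel span_add)
qed

instantiation tensor :: (real_vector, real_vector) real_vector
begin

lift_definition zero_tensor :: "('a, 'b) tensor" is 0 .

lift_definition plus_tensor :: "('a, 'b) tensor \<Rightarrow> ('a, 'b) tensor \<Rightarrow> ('a, 'b) tensor" is "(+)"
  unfolding tensor_eq_def by (metis add_diff_add span_add)

lift_definition uminus_tensor :: "('a, 'b) tensor \<Rightarrow> ('a, 'b) tensor" is uminus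
  unfolding tensor_eq_def by (metis minus_diff_minus span_neg)

lift_definition minus_tensor :: "('a, 'b) tensor \<Rightarrow> ('a, 'b) tensor \<Rightarrow> ('a, 'b) tensor" is "(-)"
proof (unfold tensor_eq_def)
  fix u u' v v' :: "('a \<times> 'b) free"
  assume "u - u' \<in> span tensor_relations" "v - v' \<in> span tensor_relations"
  then have "(u - u') - (v - v') \<in> span tensor_relations"
    by (rule span_diff)
  moreover have "(u - u') - (v - v') = u - v - (u' - v')"
    by simp
  ultimately show "u - v - (u' - v') \<in> span tensor_relations"
    by simp
qed

lift_definition scaleR_tensor :: "real \<Rightarrow> ('a, 'b) tensor \<Rightarrow> ('a, 'b) tensor" is "(*\<^sub>R)"
  unfolding tensor_eq_def by (metis scaleR_right_diff_distrib span_scale)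

instance
  by standard
    (transfer; simp add: tensor_eq_def span_zero scaleR_add_left scaleR_add_right algebra_simps)+

end

lift_definition tensor_prod :: "'a::real_vector \<Rightarrow> 'b::real_vector \<Rightarrow> ('a, 'b) tensor"
    (infixr \<open>\<otimes>\<^sub>t\<close> 75)
  is free_pair .

lemma bilinear_tensor_prod: "bilinear (\<otimes>\<^sub>t)"
  unfolding bilinear_def
proof (intro conjI allI linearI)
  show "x \<otimes>\<^sub>t (y + y') = x \<otimes>\<^sub>t y + x \<otimes>\<^sub>t y'" for x :: 'a and y y' :: 'b
    by transfer (unfold tensor_eq_def tensor_relations_def diff_diff_eq, rule span_base, blast)
  show "(x + x') \<otimes>\<^sub>t y = x \<otimes>\<^sub>t y + x' \<otimes>\<^sub>t y" for x x' :: 'a and y :: 'b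
    by transfer (unfold tensor_eq_def tensor_relations_def diff_diff_eq, rule span_base, blast)
  show "x \<otimes>\<^sub>t (c *\<^sub>R y) = c *\<^sub>R (x \<otimes>\<^sub>t y)" for c and x :: 'a and y :: 'b
    by transfer (unfold tensor_eq_def tensor_relations_def, rule span_base, blast)
  show "(c *\<^sub>R x) \<otimes>\<^sub>t y = c *\<^sub>R (x \<otimes>\<^sub>t y)" for c and x :: 'a and y :: 'b
    by transfer (unfold tensor_eq_def tensor_relations_def, rule span_base, blast)
qed

text \<open>The linear map on the tensor product induced by a bilinear map; this is independent of
  the representative because bilinear maps annihilate the relations.\<close>

definition free_lift :: "('p \<Rightarrow> 'c::real_vector) \<Rightarrow> 'p free \<Rightarrow> 'c" where
  "free_lift h u = (\<Sum>p\<in>Poly_Mapping.keys u. Poly_Mapping.lookup u p *\<^sub>R h p)"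

definition tensor_lift ::
  "('a::real_vector \<Rightarrow> 'b::real_vector \<Rightarrow> 'c::real_vector) \<Rightarrow> ('a, 'b) tensor \<Rightarrow> 'c" where
  "tensor_lift b u = free_lift (\<lambda>(x, y). b x y) (rep_tensor u)"

lemma lookup_scaleR: "Poly_Mapping.lookup (c *\<^sub>R u) p = c * Poly_Mapping.lookup u p"
  for u :: "'p free"
proof -
  have "finite {i. c * Poly_Mapping.lookup u i \<noteq> 0}"
    by (rule finite_subset[of _ "Poly_Mapping.keys u"]) (auto simp: in_keys_iff)
  then show ?thesis
    by (simp add: scaleR_poly_mapping_def)
qed

lemma linear_free_lift: "linear (free_lift h)"
proof -
  have eq: "free_lift h u = (\<Sum>p\<in>K. Poly_Mapping.lookup u p *\<^sub>R h p)"
    if "finite K" "Poly_Mapping.keys u \<subseteq> K" for u K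
    unfolding free_lift_def using that
    by (intro sum.mono_neutral_left) (auto simp: in_keys_iff)
  show ?thesis
  proof (rule linearI)
    fix u v :: "'a free" and c :: real
    let ?K = "Poly_Mapping.keys u \<union> Poly_Mapping.keys v"
    have "Poly_Mapping.keys (u + v) \<subseteq> ?K"
      by (rule Poly_Mapping.keys_add)
    then show "free_lift h (u + v) = free_lift h u + free_lift h v"
      by (simp add: eq[of ?K] lookup_add scaleR_add_left sum.distrib)
    have "Poly_Mapping.keys (c *\<^sub>R u) \<subseteq> Poly_Mapping.keys u"
      by (auto simp: in_keys_iff lookup_scaleR)
    then show "free_lift h (c *\<^sub>R u) = c *\<^sub>R free_lift h u"
      by (simp add: eq[of "Poly_Mapping.keys u"] lookup_scaleR scaleR_sum_right)
  qed
qed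

lemma free_lift_pair [simp]: "free_lift (\<lambda>(x, y). b x y) (free_pair x y) = b x y"
  by (simp add: free_lift_def free_pair_def)

lemma free_lift_eq:
  assumes "bilinear b" "tensor_eq u v"
  shows "free_lift (\<lambda>(x, y). b x y) u = free_lift (\<lambda>(x, y). b x y) v"
proof -
  interpret L: linear "free_lift (\<lambda>(x, y). b x y)"
    by (rule linear_free_lift)
  have "free_lift (\<lambda>(x, y). b x y) r = 0" if "r \<in> tensor_relations" for r
    using that unfolding tensor_relations_def
    by (auto simp: L.diff L.scaleR bilinear_ladd[OF assms(1)] bilinear_radd[OF assms(1)]
        bilinear_lmul[OF assms(1)] bilinear_rmul[OF assms(1)])
  then have "free_lift (\<lambda>(x, y). b x y) (u - v) = 0"
    using assms(2) linear_eq_0_on_span[OF linear_free_lift] unfolding tensor_eq_def by blast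
  then show ?thesis
    by (simp add: L.diff)
qed

lemma rep_tensor_eq: "tensor_eq (rep_tensor (abs_tensor u)) u"
  by (rule Quotient3_rep_abs[OF Quotient3_tensor]) (simp add: tensor_eq_def span_zero)

lemma tensor_lift_abs:
  "bilinear b \<Longrightarrow> tensor_lift b (abs_tensor u) = free_lift (\<lambda>(x, y). b x y) u"
  unfolding tensor_lift_def by (rule free_lift_eq[OF _ rep_tensor_eq])

lemma tensor_lift_prod:
  "bilinear b \<Longrightarrow> tensor_lift b (x \<otimes>\<^sub>t y) = b x y"
  by (simp add: tensor_prod.abs_eq tensor_lift_abs)

lemma linear_tensor_lift:
  assumes "bilinear b"
  shows "linear (tensor_lift b)"
proof (rule linearI)
  interpret L: linear "free_lift (\<lambda>(x, y). b x y)"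
    by (rule linear_free_lift)
  show "tensor_lift b (u + v) = tensor_lift b u + tensor_lift b v" for u v
    by (induction u; induction v)
      (simp add: plus_tensor.abs_eq tensor_lift_abs[OF assms] L.add)
  show "tensor_lift b (c *\<^sub>R u) = c *\<^sub>R tensor_lift b u" for c u
    by (induction u) (simp add: scaleR_tensor.abs_eq tensor_lift_abs[OF assms] L.scaleR)
qed

definition tensor_map ::
  "('a::real_vector \<Rightarrow> 'c::real_vector) \<Rightarrow> ('b::real_vector \<Rightarrow> 'd::real_vector) \<Rightarrow>
    ('a, 'b) tensor \<Rightarrow> ('c, 'd) tensor" where
  "tensor_map f g = tensor_lift (\<lambda>x y. f x \<otimes>\<^sub>t g y)"

lemma bilinear_map_prod:
  assumes "linear f" "linear g"
  shows "bilinear (\<lambda>x y. f x \<otimes>\<^sub>t g y)"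
  unfolding bilinear_def
  by (intro conjI allI linearI)
    (simp_all add: linear_add[OF assms(1)] linear_add[OF assms(2)] linear_scale[OF assms(1)]
      linear_scale[OF assms(2)] bilinear_ladd[OF bilinear_tensor_prod]
      bilinear_radd[OF bilinear_tensor_prod] bilinear_lmul[OF bilinear_tensor_prod]
      bilinear_rmul[OF bilinear_tensor_prod])

lemma tensor_map_prod:
  "linear f \<Longrightarrow> linear g \<Longrightarrow> tensor_map f g (x \<otimes>\<^sub>t y) = f x \<otimes>\<^sub>t g y"
  by (simp add: tensor_map_def tensor_lift_prod bilinear_map_prod)

lemma linear_tensor_map: "linear f \<Longrightarrow> linear g \<Longrightarrow> linear (tensor_map f g)"
  by (simp add: tensor_map_def linear_tensor_lift bilinear_map_prod)


section \<open>The injective and projective norms\<close>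

definition inj_norm :: "('a::real_normed_vector, 'b::real_normed_vector) tensor \<Rightarrow> real" where
  "inj_norm u =
     (SUP (f, g) \<in> {(f :: 'a \<Rightarrow>\<^sub>L real, g :: 'b \<Rightarrow>\<^sub>L real). norm f \<le> 1 \<and> norm g \<le> 1}.
        \<bar>tensor_lift (\<lambda>x y. blinfun_apply f x * blinfun_apply g y) u\<bar>)"

definition proj_norm :: "('a::real_normed_vector, 'b::real_normed_vector) tensor \<Rightarrow> real" where
  "proj_norm u =
     (INF ps \<in> {ps :: ('a \<times> 'b) list. u = (\<Sum>(x, y)\<leftarrow>ps. x \<otimes>\<^sub>t y)}.
        \<Sum>(x, y)\<leftarrow>ps. norm x * norm y)"

text \<open>The norm of a linear map from the injective to the projective tensor product. It takes
  values in the extended reals, so that it is the true supremum, possibly infinite. No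
  completion is taken: the constants below are meant for finite-dimensional first argument, and
  a tensor product with a finite-dimensional factor is complete as it stands.\<close>

definition inj_proj_opnorm ::
  "(('a::real_normed_vector, 'b::real_normed_vector) tensor \<Rightarrow>
    ('c::real_normed_vector, 'd::real_normed_vector) tensor) \<Rightarrow> ereal" where
  "inj_proj_opnorm T = (SUP u \<in> {u. inj_norm u \<le> 1}. ereal (proj_norm (T u)))"


section \<open>The constants\<close>

definition K_G :: "'a::banach itself \<Rightarrow> 'b::banach itself \<Rightarrow> ereal" where
  "K_G E F =
     (SUP A \<in> {A :: 'a \<Rightarrow>\<^sub>L ('a \<Rightarrow>\<^sub>L real). norm A \<le> 1}.
        inj_proj_opnorm (tensor_map (blinfun_apply A) (id :: 'b \<Rightarrow> 'b)))"

definition \<rho> :: "'a::banach itself \<Rightarrow> 'b::banach itself \<Rightarrow> ereal" where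
  "\<rho> E F = inj_proj_opnorm (tensor_map (id :: 'a \<Rightarrow> 'a) (id :: 'b \<Rightarrow> 'b))"

end

theory Submission
  imports Defs
begin

text \<open>
  The dual of the projective norm on \<open>X \<otimes> Y\<close> consists of the bounded bilinear forms on
  \<open>X \<times> Y\<close>. Hence, by Hahn--Banach, the projective norm of a tensor is the value of some linear
  functional of dual norm at most 1 (\<open>proj_norm_attained\<close>), and no such functional exceeds it
  (\<open>contractive_le_proj_norm\<close>). Each inequality between the
  constants moves such a functional from one tensor to another without changing its value.

  Upper bound (\<open>K_G_le_\<rho>\<close>, valid for every second space \<open>F\<close>): a contractive bilinear form on
  \<open>E* \<times> F\<close> is a contraction \<open>F \<rightarrow> E**\<close>, and \<open>E** = E\<close>, so it is
  \<open>(f, y) \<mapsto> f (b y)\<close> with a contraction \<open>b : F \<rightarrow> E\<close>. Its value at \<open>(A \<otimes> id) u\<close> is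
  the value of the bilinear form \<open>A\<close> at \<open>(id \<otimes> b) u\<close>. As \<open>id \<otimes> b\<close> does not increase the
  injective norm, the projective norm of \<open>(id \<otimes> b) u\<close> is at most \<open>\<rho>(E, E)\<close>.

  Lower bounds: let \<open>v\<close> in \<open>E \<otimes> E\<close> have injective norm at most 1. The functional that attains
  the projective norm of \<open>v\<close> is a contraction \<open>A : E \<rightarrow> E*\<close>. Its value at \<open>v\<close> is the evaluation
  pairing of \<open>E*\<close> with \<open>E\<close> applied to \<open>(A \<otimes> id) v\<close>, which gives \<open>\<rho>_le_K_G_same\<close>. It is also
  what \<open>v\<close>, read as a bilinear form on \<open>E* \<times> E*\<close>, gives on \<open>(A \<otimes> id) u\<close>, where \<open>u\<close> in
  \<open>E \<otimes> E*\<close> is the tensor of the identity operator; this \<open>u\<close> has injective norm at most 1,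
  which gives \<open>\<rho>_le_K_G_dual\<close>.

  The space is only assumed to be spanned by a finite set, so the identity operator is first
  resolved into bounded functionals and vectors (\<open>exists_frame\<close>); this yields reflexivity and
  the tensor \<open>u\<close> without any comparison of norms.
\<close>

section \<open>The Hahn--Banach theorem\<close>

definition sublinear :: "('a::real_vector \<Rightarrow> real) \<Rightarrow> bool" where
  "sublinear p \<longleftrightarrow> (\<forall>x y. p (x + y) \<le> p x + p y) \<and> (\<forall>t\<ge>0. \<forall>x. p (t *\<^sub>R x) \<le> t * p x)"

lemma sublinear_add: "sublinear p \<Longrightarrow> p (x + y) \<le> p x + p y"
  by (simp add: sublinear_def)

lemma sublinear_zero: "sublinear p \<Longrightarrow> p 0 = 0"
  unfolding sublinear_def by (metis add.right_neutral add_le_cancel_left mult_zero_left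
      order_antisym order_refl scale_zero_left)

lemma sublinear_scale:
  assumes "sublinear p" "t \<ge> 0"
  shows "p (t *\<^sub>R x) = t * p x"
proof (cases "t = 0")
  case True
  then show ?thesis by (simp add: sublinear_zero[OF assms(1)])
next
  case False
  then have t: "t > 0" using assms by simp
  have "p (inverse t *\<^sub>R (t *\<^sub>R x)) \<le> inverse t * p (t *\<^sub>R x)"
    using assms t unfolding sublinear_def by (meson inverse_nonnegative_iff_nonnegative)
  then have "t * p x \<le> p (t *\<^sub>R x)"
    using t by (simp add: field_simps)
  moreover have "p (t *\<^sub>R x) \<le> t * p x"
    using assms unfolding sublinear_def by blast
  ultimately show ?thesis by simp
qed

lemma sublinear_neg: "sublinear p \<Longrightarrow> - p (- x) \<le> p x"
  using sublinear_add[of p x "- x"] sublinear_zero[of p] by simp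

text \<open>The largest sublinear functional below \<open>p\<close> that sends \<open>- x\<close> to \<open>- p x\<close>; it is the
  device that turns sublinear functionals into ones that are additive along \<open>x\<close>.\<close>

definition tilt :: "('a::real_vector \<Rightarrow> real) \<Rightarrow> 'a \<Rightarrow> 'a \<Rightarrow> real" where
  "tilt p x z = (INF t\<in>{0..}. p (z + t *\<^sub>R x) - t * p x)"

lemma tilt_lower:
  assumes "sublinear p" "t \<ge> 0"
  shows "tilt p x z \<le> p (z + t *\<^sub>R x) - t * p x"
  unfolding tilt_def
proof (rule cINF_lower)
  have "- p (- z) \<le> p (z + t *\<^sub>R x) - t * p x" if "t \<ge> 0" for t
    using sublinear_add[OF assms(1), of "z + t *\<^sub>R x" "- z"] sublinear_scale[OF assms(1) that, of x]
    by simp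
  then show "bdd_below ((\<lambda>t. p (z + t *\<^sub>R x) - t * p x) ` {0..})"
    by (auto simp: bdd_below_def)
qed (use assms in simp)

lemma tilt_greatest:
  assumes "\<And>t. t \<ge> 0 \<Longrightarrow> c \<le> p (z + t *\<^sub>R x) - t * p x"
  shows "c \<le> tilt p x z"
  unfolding tilt_def by (rule cINF_greatest) (use assms in auto)

lemma tilt_le: "sublinear p \<Longrightarrow> tilt p x z \<le> p z"
  using tilt_lower[of p 0 x z] by simp

lemma sublinear_tilt:
  assumes "sublinear p"
  shows "sublinear (tilt p x)"
  unfolding sublinear_def
proof (intro conjI allI impI)
  fix y z
  have 1: "tilt p x (y + z) - (p (z + t *\<^sub>R x) - t * p x) \<le> p (y + s *\<^sub>R x) - s * p x"
    if "s \<ge> 0" "t \<ge> 0" for s t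
    using tilt_lower[OF assms, of "s + t" x "y + z"] that
      sublinear_add[OF assms, of "y + s *\<^sub>R x" "z + t *\<^sub>R x"]
    by (simp add: algebra_simps)
  have 2: "tilt p x (y + z) - (p (z + t *\<^sub>R x) - t * p x) \<le> tilt p x y" if "t \<ge> 0" for t
    by (rule tilt_greatest) (use 1 that in auto)
  have "tilt p x (y + z) - tilt p x y \<le> tilt p x z"
    by (rule tilt_greatest) (use 2 in force)
  then show "tilt p x (y + z) \<le> tilt p x y + tilt p x z" by simp
next
  fix s :: real and z
  assume s: "0 \<le> s"
  show "tilt p x (s *\<^sub>R z) \<le> s * tilt p x z"
  proof (cases "s = 0")
    case True
    then show ?thesis
      using tilt_le[OF assms, of x 0] sublinear_zero[OF assms] by simp
  next
    case False
    with s have s: "s > 0" by simp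
    have "tilt p x (s *\<^sub>R z) / s \<le> tilt p x z"
    proof (rule tilt_greatest)
      fix t :: real assume t: "t \<ge> 0"
      have "tilt p x (s *\<^sub>R z) \<le> p (s *\<^sub>R z + (s * t) *\<^sub>R x) - (s * t) * p x"
        by (rule tilt_lower[OF assms]) (use s t in simp)
      also have "s *\<^sub>R z + (s * t) *\<^sub>R x = s *\<^sub>R (z + t *\<^sub>R x)"
        by (simp add: scaleR_add_right)
      also have "p \<dots> = s * p (z + t *\<^sub>R x)"
        using s by (simp add: sublinear_scale[OF assms])
      finally show "tilt p x (s *\<^sub>R z) / s \<le> p (z + t *\<^sub>R x) - t * p x"
        using s by (simp add: field_simps)
    qed
    then show ?thesis using s by (simp add: field_simps)
  qed
qed

text \<open>A minimal functional equals all of its tilts, and the tilt along \<open>x\<close> makes the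
  subadditivity inequality for adding \<open>x\<close> an equality.\<close>

lemma minimal_sublinear_is_linear:
  assumes q: "sublinear q"
    and minimal: "\<And>r. sublinear r \<Longrightarrow> r \<le> q \<Longrightarrow> r = q"
  shows "linear q"
proof -
  have "tilt q x = q" for x
    by (rule minimal) (use q in \<open>auto simp: sublinear_tilt tilt_le le_fun_def\<close>)
  then have "q z + q x \<le> q (z + x)" for x z
    using tilt_lower[OF q, of 1 x z] by simp
  then have add: "q (z + x) = q z + q x" for x z
    using sublinear_add[OF q, of z x] by (simp add: order_antisym)
  have neg: "q (- x) = - q x" for x
    using add[of x "- x"] sublinear_zero[OF q] by simp
  show ?thesis
  proof (rule linearI)
    show "q (c *\<^sub>R x) = c *\<^sub>R q x" for c x
      using sublinear_scale[OF q, of c x] sublinear_scale[OF q, of "- c" x] neg[of "c *\<^sub>R x"]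
      by (cases "c \<ge> 0") auto
  qed (rule add)
qed

text \<open>Zorn's lemma applies because the pointwise infimum of a chain is finite, each \<open>q\<close> in it
  being bounded below at \<open>z\<close> by \<open>- p (- z)\<close>, and subadditive, any two members having a common
  lower one.\<close>

lemma exists_minimal_sublinear:
  fixes p :: "'a::real_vector \<Rightarrow> real"
  assumes p: "sublinear p"
  obtains q where "sublinear q" "q \<le> p" "\<And>r. sublinear r \<Longrightarrow> r \<le> q \<Longrightarrow> r = q"
proof -
  let ?A = "{q. sublinear q \<and> q \<le> p}"
  let ?P = "\<lambda>q r :: 'a \<Rightarrow> real. r \<le> q"
  have "\<exists>q\<in>?A. \<forall>r\<in>?A. ?P q r \<longrightarrow> r = q"
  proof (rule predicate_Zorn)
    show "partial_order_on ?A (relation_of ?P ?A)"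
      by (auto simp: partial_order_on_def preorder_on_def refl_on_def trans_def antisym_def
          relation_of_def)
    fix C assume "C \<in> Chains (relation_of ?P ?A)"
    then have C: "q \<in> C \<Longrightarrow> sublinear q \<and> q \<le> p" and tot: "q \<in> C \<Longrightarrow> r \<in> C \<Longrightarrow> q \<le> r \<or> r \<le> q"
      for q r
      unfolding Chains_def relation_of_def by auto
    show "\<exists>u\<in>?A. \<forall>q\<in>C. u \<le> q"
    proof (cases "C = {}")
      case True
      then show ?thesis using p by auto
    next
      case False
      define u where "u z = (INF q\<in>C. q z)" for z
      have lower: "u z \<le> q z" if "q \<in> C" for q z
        unfolding u_def
      proof (rule cINF_lower)
        have "- p (- z) \<le> q z" if "q \<in> C" for q
          using sublinear_neg[of q z] C[OF that] by (fastforce simp: le_fun_def dest: spec[of _ "- z"])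
        then show "bdd_below ((\<lambda>q. q z) ` C)" by (auto simp: bdd_below_def)
      qed (rule that)
      have greatest: "c \<le> u z" if "\<And>q. q \<in> C \<Longrightarrow> c \<le> q z" for c z
        unfolding u_def by (rule cINF_greatest) (use False that in auto)
      have "sublinear u"
        unfolding sublinear_def
      proof (intro conjI allI impI)
        fix y z
        \<comment> \<open>For members \<open>q\<close> and \<open>r\<close> of the chain, the smaller one is subadditive and lies below both.\<close>
        have 1: "u (y + z) - r z \<le> q y" if qr: "q \<in> C" "r \<in> C" for q r
        proof -
          obtain m where m: "m \<in> C" "m \<le> q" "m \<le> r"
            using tot[OF qr] qr by auto
          have "u (y + z) \<le> m (y + z)" by (rule lower[OF m(1)])
          also have "\<dots> \<le> m y + m z" using C[OF m(1)] sublinear_add by blast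
          also have "\<dots> \<le> q y + r z" using m by (auto simp: le_fun_def intro: add_mono)
          finally show ?thesis by simp
        qed
        have 2: "u (y + z) - r z \<le> u y" if "r \<in> C" for r
          by (rule greatest) (use 1 that in auto)
        have "u (y + z) - u y \<le> u z"
          by (rule greatest) (use 2 in force)
        then show "u (y + z) \<le> u y + u z" by simp
      next
        fix t :: real and z assume t: "0 \<le> t"
        obtain q where q: "q \<in> C" using False by auto
        show "u (t *\<^sub>R z) \<le> t * u z"
        proof (cases "t = 0")
          case True
          then show ?thesis using lower[OF q, of 0] C[OF q] sublinear_zero[of q] by simp
        next
          case False
          with t have t: "t > 0" by simp
          have "u (t *\<^sub>R z) / t \<le> u z"
          proof (rule greatest)
            fix q assume q: "q \<in> C"
            then show "u (t *\<^sub>R z) / t \<le> q z"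
              using lower[OF q, of "t *\<^sub>R z"] sublinear_scale[of q t z] C[OF q] t
              by (simp add: field_simps)
          qed
          then show ?thesis using t by (simp add: field_simps)
        qed
      qed
      moreover have "u \<le> p"
        using False lower C by (fastforce simp: le_fun_def intro: order_trans)
      ultimately show ?thesis
        using lower by (auto simp: le_fun_def intro!: bexI[of _ u])
    qed
  qed
  then show ?thesis
    using that order_trans by (metis (mono_tags, lifting) mem_Collect_eq)
qed

text \<open>Every linear functional below the tilt of \<open>p\<close> along \<open>a\<close> is at most \<open>- p a\<close> at \<open>- a\<close>,
  hence attains \<open>p\<close> at \<open>a\<close>; a minimal sublinear functional below the tilt is linear.\<close>

theorem Hahn_Banach_sublinear:
  fixes p :: "'a::real_vector \<Rightarrow> real"
  assumes p: "sublinear p"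
  obtains f where "linear f" "\<And>x. f x \<le> p x" "f a = p a"
proof -
  obtain f where f: "sublinear f" "f \<le> tilt p a" "\<And>r. sublinear r \<Longrightarrow> r \<le> f \<Longrightarrow> r = f"
    by (rule exists_minimal_sublinear[OF sublinear_tilt[OF p, of a]]) blast
  have lin: "linear f" by (rule minimal_sublinear_is_linear[OF f(1,3)])
  have le: "f x \<le> p x" for x
    using f(2) tilt_le[OF p] by (metis le_fun_def order_trans)
  have "f (- a) \<le> tilt p a (- a)" using f(2) by (simp add: le_fun_def)
  also have "\<dots> \<le> - p a"
    using tilt_lower[OF p, of 1 a "- a"] sublinear_zero[OF p] by simp
  finally have "f a = p a"
    using le[of a] linear_neg[OF lin, of a] by simp
  with that lin le show ?thesis by blast
qed

corollary norming_functional: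
  fixes x :: "'a::real_normed_vector"
  obtains f :: "'a \<Rightarrow>\<^sub>L real" where "norm f \<le> 1" "f x = norm x"
proof -
  have "sublinear (norm :: 'a \<Rightarrow> real)"
    by (simp add: sublinear_def norm_triangle_ineq)
  then obtain f where f: "linear f" "\<And>y::'a. f y \<le> norm y" "f x = norm x"
    by (rule Hahn_Banach_sublinear[where a = x]) blast
  have b: "norm (f y) \<le> norm y * 1" for y
    using f(2)[of y] f(2)[of "- y"] linear_neg[OF f(1), of y] by simp
  have bl: "bounded_linear f"
    by (rule bounded_linear_intro[OF linear_add[OF f(1)] linear_scale[OF f(1)] b])
  show ?thesis
  proof (rule that[of "Blinfun f"])
    show "norm (Blinfun f) \<le> 1"
      by (rule norm_blinfun_bound) (use b in \<open>auto simp: bounded_linear_Blinfun_apply[OF bl]\<close>)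
  qed (simp add: bounded_linear_Blinfun_apply[OF bl] f)
qed

section \<open>Reflexivity of finite-dimensional spaces\<close>

text \<open>A resolution of the identity on \<open>S\<close> by finitely many pairs of a functional and a vector.
  It plays the part of a basis with its dual basis, but no independence is asked for, which
  allows the list to grow by one pair per spanning vector. The functionals are bounded by
  their type, so the automatic continuity of linear functionals on finite-dimensional spaces
  does not have to be known beforehand.\<close>

definition frame :: "(('a::real_normed_vector \<Rightarrow>\<^sub>L real) \<times> 'a) list \<Rightarrow> 'a set \<Rightarrow> bool" where
  "frame fs S \<longleftrightarrow> (\<forall>x\<in>S. x = (\<Sum>(f, c)\<leftarrow>fs. blinfun_apply f x *\<^sub>R c))"

lemma bounded_linear_frame_sum:
  "bounded_linear (\<lambda>x. \<Sum>(f, c)\<leftarrow>fs. blinfun_apply f x *\<^sub>R c)"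
  by (induction fs) (auto intro!: bounded_linear_intros)

text \<open>Suppose that \<open>P\<close>, the operator of the frame found so far, fixes \<open>span B\<close>. The residue
  \<open>r = b - P b\<close> of a new vector \<open>b\<close> is repaired by the rank-one term \<open>x \<mapsto> f (x - P x) / norm r * r\<close>,
  where \<open>f r = norm r\<close>: it vanishes on \<open>span B\<close> and takes \<open>b\<close> to \<open>r\<close>. If \<open>r = 0\<close>, the
  division by zero makes the added term vanish, as it should.\<close>

lemma exists_frame:
  fixes B :: "'a::real_normed_vector set"
  assumes "finite B"
  shows "\<exists>fs. frame fs (span B)"
  using assms
proof (induction B)
  case empty
  have "frame [] (span {} :: 'a set)"
    by (simp add: frame_def)
  then show ?case by blast
next
  case (insert b B)
  then obtain fs where fs: "frame fs (span B)" by blast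
  define P where "P x = (\<Sum>(f, c)\<leftarrow>fs. blinfun_apply f x *\<^sub>R c)" for x
  have P: "bounded_linear P"
    unfolding P_def by (rule bounded_linear_frame_sum)
  interpret P: bounded_linear P by (rule P)
  have PB: "P x = x" if "x \<in> span B" for x
    using fs that by (simp add: frame_def P_def)
  define r where "r = b - P b"
  obtain f where f: "norm f \<le> 1" "blinfun_apply f r = norm r"
    by (rule norming_functional)
  define g where "g = Blinfun (\<lambda>x. blinfun_apply f (x - P x) / norm r)"
  have "bounded_linear (\<lambda>x. blinfun_apply f (x - P x) / norm r)"
    unfolding divide_inverse
    by (intro bounded_linear_mult_const bounded_linear_compose[OF bounded_linear_blinfun_apply[OF bounded_linear_ident]]
        bounded_linear_sub bounded_linear_ident P)
  then have g: "blinfun_apply g x = blinfun_apply f (x - P x) / norm r" for x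
    by (simp add: g_def bounded_linear_Blinfun_apply)
  have "frame ((g, r) # fs) (span (insert b B))"
    unfolding frame_def
  proof
    fix x assume "x \<in> span (insert b B)"
    then obtain k where k: "x - k *\<^sub>R b \<in> span B"
      by (auto simp: span_insert)
    have Pk: "P x = x - k *\<^sub>R r"
      using PB[OF k] by (simp add: P.diff P.scaleR r_def algebra_simps)
    have "blinfun_apply g x *\<^sub>R r = k *\<^sub>R r"
      using f(2) by (simp add: g Pk blinfun.scaleR_right)
    then show "x = (\<Sum>(f, c)\<leftarrow>(g, r) # fs. blinfun_apply f x *\<^sub>R c)"
      using Pk by (simp add: P_def)
  qed
  then show ?case by blast
qed

lemma frame_dual:
  assumes "frame fs UNIV"
  shows "(h :: 'a::real_normed_vector \<Rightarrow>\<^sub>L real) = (\<Sum>(f, c)\<leftarrow>fs. blinfun_apply h c *\<^sub>R f)"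
proof (rule blinfun_eqI)
  fix x
  have 1: "blinfun_apply h (\<Sum>(f, c)\<leftarrow>fs'. blinfun_apply f x *\<^sub>R c)
      = blinfun_apply (\<Sum>(f, c)\<leftarrow>fs'. blinfun_apply h c *\<^sub>R f) x"
    for fs' :: "(('a \<Rightarrow>\<^sub>L real) \<times> 'a) list"
    by (induction fs') (auto simp: blinfun.bilinear_simps)
  have "x = (\<Sum>(f, c)\<leftarrow>fs. blinfun_apply f x *\<^sub>R c)"
    using assms unfolding frame_def by blast
  then show "blinfun_apply h x = blinfun_apply (\<Sum>(f, c)\<leftarrow>fs. blinfun_apply h c *\<^sub>R f) x"
    using 1[of fs] by metis
qed

text \<open>Reflexivity: a linear functional on the dual space is evaluation at the vector obtained by
  applying it to the functionals of the frame.\<close>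

lemma frame_bidual_eval:
  assumes "frame fs UNIV" "linear G"
  shows "blinfun_apply (h :: 'a::real_normed_vector \<Rightarrow>\<^sub>L real) (\<Sum>(f, c)\<leftarrow>fs. G f *\<^sub>R c) = G h"
proof -
  have 1: "blinfun_apply h (\<Sum>(f, c)\<leftarrow>fs'. G f *\<^sub>R c) = G (\<Sum>(f, c)\<leftarrow>fs'. blinfun_apply h c *\<^sub>R f)"
    for fs' :: "(('a \<Rightarrow>\<^sub>L real) \<times> 'a) list"
    by (induction fs')
      (auto simp: blinfun.bilinear_simps linear_add[OF assms(2)] linear_scale[OF assms(2)]
        linear_0[OF assms(2)])
  show ?thesis using 1 frame_dual[OF assms(1), of h] by metis
qed

section \<open>Duality for the two tensor norms\<close>

text \<open>The scalar coefficients of an element of the free space are absorbed into the first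
  factors, so that a sum over a list of pure tensors is enough.\<close>

lemma tensor_list_rep:
  fixes u :: "('a::real_vector, 'b::real_vector) tensor"
  shows "\<exists>ps. u = (\<Sum>(x, y)\<leftarrow>ps. x \<otimes>\<^sub>t y)"
proof -
  have "\<exists>ps. abs_tensor r = (\<Sum>(x, y)\<leftarrow>ps. x \<otimes>\<^sub>t y)" for r :: "('a \<times> 'b) free"
  proof (induction r rule: update_induct)
    case const
    have "abs_tensor 0 = (\<Sum>(x :: 'a, y :: 'b)\<leftarrow>[]. x \<otimes>\<^sub>t y)"
      by (simp add: zero_tensor_def)
    then show ?case by blast
  next
    case (update f k v)
    obtain x y where k: "k = (x, y)" by (cases k)
    have "Poly_Mapping.update k v f = v *\<^sub>R free_pair x y + f"
      using update(1)
      by (intro poly_mapping_eqI)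
        (auto simp: k free_pair_def lookup_scaleR lookup_single lookup_update lookup_add in_keys_iff when_def)
    then have 1: "abs_tensor (Poly_Mapping.update k v f) = (v *\<^sub>R x) \<otimes>\<^sub>t y + abs_tensor f"
      by (simp add: plus_tensor.abs_eq[symmetric] scaleR_tensor.abs_eq[symmetric]
          tensor_prod.abs_eq[symmetric] bilinear_lmul[OF bilinear_tensor_prod])
    obtain ps where "abs_tensor f = (\<Sum>(x, y)\<leftarrow>ps. x \<otimes>\<^sub>t y)"
      using update(3) by blast
    then have "abs_tensor (Poly_Mapping.update k v f) = (\<Sum>(x, y)\<leftarrow>(v *\<^sub>R x, y) # ps. x \<otimes>\<^sub>t y)"
      by (simp add: 1)
    then show ?case by blast
  qed
  then show ?thesis
    by (metis Quotient3_abs_rep Quotient3_tensor)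
qed

lemma linear_tensor_list:
  assumes "linear \<phi>"
  shows "\<phi> (\<Sum>(x, y)\<leftarrow>ps. x \<otimes>\<^sub>t y) = (\<Sum>(x, y)\<leftarrow>ps. \<phi> (x \<otimes>\<^sub>t y))"
  by (induction ps) (auto simp: linear_0[OF assms] linear_add[OF assms])

lemma tensor_lift_list:
  assumes "bilinear b"
  shows "tensor_lift b (\<Sum>(x, y)\<leftarrow>ps. x \<otimes>\<^sub>t y) = (\<Sum>(x, y)\<leftarrow>ps. b x y)"
  by (simp add: linear_tensor_list[OF linear_tensor_lift[OF assms]] tensor_lift_prod[OF assms])

lemma linear_tensor_ext:
  assumes "linear \<phi>" "linear \<psi>" "\<And>x y. \<phi> (x \<otimes>\<^sub>t y) = \<psi> (x \<otimes>\<^sub>t y)"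
  shows "\<phi> u = \<psi> u"
proof -
  obtain ps where "u = (\<Sum>(x, y)\<leftarrow>ps. x \<otimes>\<^sub>t y)" using tensor_list_rep by blast
  then show ?thesis by (simp add: linear_tensor_list assms)
qed

lemma proj_norm_le:
  assumes "u = (\<Sum>(x, y)\<leftarrow>ps. x \<otimes>\<^sub>t y)"
  shows "proj_norm u \<le> (\<Sum>(x, y)\<leftarrow>ps. norm x * norm y)"
  unfolding proj_norm_def
proof (rule cINF_lower)
  have "0 \<le> (\<Sum>(x, y)\<leftarrow>qs. norm x * norm y)" for qs :: "('a \<times> 'b) list"
    by (rule sum_list_nonneg) auto
  then show "bdd_below ((\<lambda>ps. \<Sum>(x, y)\<leftarrow>ps. norm x * norm y) ` {ps. u = (\<Sum>(x, y)\<leftarrow>ps. x \<otimes>\<^sub>t y)})"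
    by (auto simp: bdd_below_def)
qed (use assms in simp)

lemma proj_norm_greatest:
  assumes "\<And>ps. u = (\<Sum>(x, y)\<leftarrow>ps. x \<otimes>\<^sub>t y) \<Longrightarrow> c \<le> (\<Sum>(x, y)\<leftarrow>ps. norm x * norm y)"
  shows "c \<le> proj_norm u"
  unfolding proj_norm_def
  by (rule cINF_greatest) (use assms tensor_list_rep[of u] in auto)

lemma sublinear_proj_norm:
  "sublinear (proj_norm :: ('a::real_normed_vector, 'b::real_normed_vector) tensor \<Rightarrow> real)"
  unfolding sublinear_def
proof (intro conjI allI impI)
  fix u v :: "('a, 'b) tensor"
  have 1: "proj_norm (u + v) - (\<Sum>(x, y)\<leftarrow>qs. norm x * norm y) \<le> (\<Sum>(x, y)\<leftarrow>ps. norm x * norm y)"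
    if "u = (\<Sum>(x, y)\<leftarrow>ps. x \<otimes>\<^sub>t y)" "v = (\<Sum>(x, y)\<leftarrow>qs. x \<otimes>\<^sub>t y)" for ps qs
    using proj_norm_le[of "u + v" "ps @ qs"] that by simp
  have 2: "proj_norm (u + v) - (\<Sum>(x, y)\<leftarrow>qs. norm x * norm y) \<le> proj_norm u"
    if "v = (\<Sum>(x, y)\<leftarrow>qs. x \<otimes>\<^sub>t y)" for qs
    by (rule proj_norm_greatest) (rule 1[OF _ that])
  have "proj_norm (u + v) - proj_norm u \<le> proj_norm v"
    by (rule proj_norm_greatest) (use 2 in force)
  then show "proj_norm (u + v) \<le> proj_norm u + proj_norm v" by simp
next
  fix t :: real and u :: "('a, 'b) tensor"
  assume t: "0 \<le> t"
  show "proj_norm (t *\<^sub>R u) \<le> t * proj_norm u"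
  proof (cases "t = 0")
    case True
    then show ?thesis using proj_norm_le[of "0 :: ('a, 'b) tensor" "[]"] by simp
  next
    case False
    with t have t: "t > 0" by simp
    have "proj_norm (t *\<^sub>R u) / t \<le> proj_norm u"
    proof (rule proj_norm_greatest)
      fix ps assume u: "u = (\<Sum>(x, y)\<leftarrow>ps. x \<otimes>\<^sub>t y)"
      let ?qs = "map (\<lambda>(x, y). (t *\<^sub>R x, y)) ps"
      have "t *\<^sub>R (\<Sum>(x, y)\<leftarrow>ps. x \<otimes>\<^sub>t y) = (\<Sum>(x, y)\<leftarrow>?qs. x \<otimes>\<^sub>t y)"
        by (induction ps) (auto simp: scaleR_add_right bilinear_lmul[OF bilinear_tensor_prod])
      with u have "proj_norm (t *\<^sub>R u) \<le> (\<Sum>(x, y)\<leftarrow>?qs. norm x * norm y)"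
        by (intro proj_norm_le) simp
      also have "\<dots> = t * (\<Sum>(x, y)\<leftarrow>ps. norm x * norm y)"
        using t by (induction ps) (auto simp: algebra_simps)
      finally show "proj_norm (t *\<^sub>R u) / t \<le> (\<Sum>(x, y)\<leftarrow>ps. norm x * norm y)"
        using t by (simp add: field_simps)
    qed
    then show ?thesis using t by (simp add: field_simps)
  qed
qed

text \<open>The easy half of the duality: the triangle inequality, applied to each representation.\<close>

lemma contractive_le_proj_norm:
  fixes \<phi> :: "('a::real_normed_vector, 'b::real_normed_vector) tensor \<Rightarrow> real"
  assumes "linear \<phi>" "\<And>x y. \<bar>\<phi> (x \<otimes>\<^sub>t y)\<bar> \<le> norm x * norm y"
  shows "\<bar>\<phi> u\<bar> \<le> proj_norm u"
proof (rule proj_norm_greatest)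
  fix ps assume u: "u = (\<Sum>(x, y)\<leftarrow>ps. x \<otimes>\<^sub>t y)"
  have "\<bar>\<Sum>(x, y)\<leftarrow>ps. \<phi> (x \<otimes>\<^sub>t y)\<bar> \<le> (\<Sum>(x, y)\<leftarrow>ps. norm x * norm y)"
  proof (induction ps)
    case (Cons p ps)
    then show ?case using assms(2)[of "fst p" "snd p"] by (auto simp: split_beta)
  qed simp
  then show "\<bar>\<phi> u\<bar> \<le> (\<Sum>(x, y)\<leftarrow>ps. norm x * norm y)"
    by (simp add: u linear_tensor_list assms(1))
qed

text \<open>The other half is Hahn--Banach for the projective norm, which is at most
  \<open>norm x * norm y\<close> on a pure tensor.\<close>

lemma proj_norm_attained:
  fixes u :: "('a::real_normed_vector, 'b::real_normed_vector) tensor"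
  obtains \<phi> where "linear \<phi>" "\<And>x y. \<bar>\<phi> (x \<otimes>\<^sub>t y)\<bar> \<le> norm x * norm y" "\<phi> u = proj_norm u"
proof -
  obtain \<phi> where \<phi>: "linear \<phi>" "\<And>w :: ('a, 'b) tensor. \<phi> w \<le> proj_norm w" "\<phi> u = proj_norm u"
    by (rule Hahn_Banach_sublinear[OF sublinear_proj_norm, where a = u]) blast
  have le: "\<phi> (x \<otimes>\<^sub>t y) \<le> norm x * norm y" for x y
    using \<phi>(2)[of "x \<otimes>\<^sub>t y"] proj_norm_le[of "x \<otimes>\<^sub>t y" "[(x, y)]"] by simp
  have "\<bar>\<phi> (x \<otimes>\<^sub>t y)\<bar> \<le> norm x * norm y" for x y
    using le[of x y] le[of "- x" y] bilinear_lneg[OF bilinear_tensor_prod, of x y]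
      linear_neg[OF \<phi>(1), of "x \<otimes>\<^sub>t y"] by simp
  with that \<phi> show ?thesis by blast
qed

text \<open>The identification of bilinear forms of norm at most 1 with contractions into the dual.\<close>

lemma curry_functional:
  fixes \<phi> :: "('a::real_normed_vector, 'b::real_normed_vector) tensor \<Rightarrow> real"
  assumes lin: "linear \<phi>" and bd: "\<And>x y. \<bar>\<phi> (x \<otimes>\<^sub>t y)\<bar> \<le> norm x * norm y"
  obtains A :: "'a \<Rightarrow>\<^sub>L ('b \<Rightarrow>\<^sub>L real)" where "norm A \<le> 1" "\<And>x y. A x y = \<phi> (x \<otimes>\<^sub>t y)"
proof -
  note simps = linear_add[OF lin] linear_scale[OF lin]
    bilinear_ladd[OF bilinear_tensor_prod] bilinear_radd[OF bilinear_tensor_prod]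
    bilinear_lmul[OF bilinear_tensor_prod] bilinear_rmul[OF bilinear_tensor_prod]
  have "bounded_linear (\<lambda>y. \<phi> (x \<otimes>\<^sub>t y))" for x
    by (rule bounded_linear_intro[where K = "norm x"]) (use bd in \<open>auto simp: simps mult.commute\<close>)
  then have in_app: "blinfun_apply (Blinfun (\<lambda>y. \<phi> (x \<otimes>\<^sub>t y))) y = \<phi> (x \<otimes>\<^sub>t y)" for x y
    by (simp add: bounded_linear_Blinfun_apply)
  have in_norm: "norm (Blinfun (\<lambda>y. \<phi> (x \<otimes>\<^sub>t y))) \<le> norm x" for x
    by (rule norm_blinfun_bound) (use bd in \<open>auto simp: in_app\<close>)
  have "bounded_linear (\<lambda>x. Blinfun (\<lambda>y. \<phi> (x \<otimes>\<^sub>t y)))"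
  proof (rule bounded_linear_intro[where K = 1])
    show "Blinfun (\<lambda>y. \<phi> ((x + x') \<otimes>\<^sub>t y))
        = Blinfun (\<lambda>y. \<phi> (x \<otimes>\<^sub>t y)) + Blinfun (\<lambda>y. \<phi> (x' \<otimes>\<^sub>t y))" for x x'
      by (rule blinfun_eqI) (simp only: in_app blinfun.bilinear_simps, simp add: simps)
    show "Blinfun (\<lambda>y. \<phi> ((c *\<^sub>R x) \<otimes>\<^sub>t y)) = c *\<^sub>R Blinfun (\<lambda>y. \<phi> (x \<otimes>\<^sub>t y))" for c x
      by (rule blinfun_eqI) (simp only: in_app blinfun.bilinear_simps, simp add: simps)
  qed (use in_norm in simp)
  then have app: "blinfun_apply (Blinfun (\<lambda>x. Blinfun (\<lambda>y. \<phi> (x \<otimes>\<^sub>t y)))) x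
      = Blinfun (\<lambda>y. \<phi> (x \<otimes>\<^sub>t y))" for x
    by (simp add: bounded_linear_Blinfun_apply)
  show ?thesis
  proof (rule that)
    show "norm (Blinfun (\<lambda>x. Blinfun (\<lambda>y. \<phi> (x \<otimes>\<^sub>t y)))) \<le> 1"
      by (rule norm_blinfun_bound) (use in_norm in \<open>auto simp: app\<close>)
  qed (simp add: app in_app)
qed

lemma bilinear_functional_pair:
  "bilinear (\<lambda>x y. blinfun_apply f x * blinfun_apply g y :: real)"
  unfolding bilinear_def by (auto intro!: linearI simp: blinfun.bilinear_simps algebra_simps)

text \<open>The supremum that defines the injective norm is over a bounded set, because the projective
  norm bounds its members.\<close>

lemma functional_pair_le_inj_norm:
  assumes "norm f \<le> 1" "norm g \<le> 1"
  shows "\<bar>tensor_lift (\<lambda>x y. blinfun_apply f x * blinfun_apply g y) u\<bar> \<le> inj_norm u"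
proof -
  have "\<bar>tensor_lift (\<lambda>x y. blinfun_apply f x * blinfun_apply g y) u\<bar> \<le> proj_norm u"
    if "norm f \<le> 1" "norm g \<le> 1" for f :: "'a \<Rightarrow>\<^sub>L real" and g :: "'b \<Rightarrow>\<^sub>L real"
  proof (rule contractive_le_proj_norm[OF linear_tensor_lift[OF bilinear_functional_pair]])
    fix x :: 'a and y :: 'b
    have "\<bar>f x\<bar> \<le> norm x" "\<bar>g y\<bar> \<le> norm y"
      using norm_blinfun[of f x] norm_blinfun[of g y]
        mult_right_mono[OF that(1), of "norm x"] mult_right_mono[OF that(2), of "norm y"]
      by simp_all
    then show "\<bar>tensor_lift (\<lambda>x y. blinfun_apply f x * blinfun_apply g y) (x \<otimes>\<^sub>t y)\<bar>
        \<le> norm x * norm y"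
      by (simp add: tensor_lift_prod[OF bilinear_functional_pair] abs_mult mult_mono)
  qed
  note bound = this
  have "bdd_above ((\<lambda>(f, g). \<bar>tensor_lift (\<lambda>x y. blinfun_apply f x * blinfun_apply g y) u\<bar>)
      ` {(f :: 'a \<Rightarrow>\<^sub>L real, g :: 'b \<Rightarrow>\<^sub>L real). norm f \<le> 1 \<and> norm g \<le> 1})"
    by (rule bdd_aboveI[where M = "proj_norm u"]) (use bound in auto)
  from cSUP_upper[OF _ this, of "(f, g)"] assms show ?thesis
    by (simp add: inj_norm_def)
qed

lemma inj_norm_least:
  assumes "\<And>f g. norm f \<le> 1 \<Longrightarrow> norm g \<le> 1 \<Longrightarrow>
    \<bar>tensor_lift (\<lambda>x y. blinfun_apply f x * blinfun_apply g y) u\<bar> \<le> c"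
  shows "inj_norm u \<le> c"
  unfolding inj_norm_def
proof (rule cSUP_least)
  show "{(f :: 'a \<Rightarrow>\<^sub>L real, g :: 'b \<Rightarrow>\<^sub>L real). norm f \<le> 1 \<and> norm g \<le> 1} \<noteq> {}"
    by (auto intro!: exI[of _ 0])
qed (use assms in auto)

lemma linear_map_right:
  assumes "linear T"
  shows "linear (tensor_map id T)"
  by (rule linear_tensor_map[OF _ assms]) (simp add: linear_id)

text \<open>Composing with a contraction maps the unit ball of the dual of its target into that of its
  source, so each value in the supremum on the left also occurs on the right.\<close>

lemma inj_norm_map_right:
  fixes u :: "('a::real_normed_vector, 'b::real_normed_vector) tensor"
    and T :: "'b \<Rightarrow>\<^sub>L 'c::real_normed_vector"
  assumes "norm T \<le> 1"
  shows "inj_norm (tensor_map id T u) \<le> inj_norm u"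
proof (rule inj_norm_least)
  fix f :: "'a \<Rightarrow>\<^sub>L real" and g :: "'c \<Rightarrow>\<^sub>L real"
  assume f: "norm f \<le> 1" and g: "norm g \<le> 1"
  have T: "linear (blinfun_apply T)"
    by (simp add: bounded_linear.linear blinfun.bounded_linear_right)
  have "tensor_lift (\<lambda>x y. blinfun_apply f x * blinfun_apply g y) (tensor_map id T u)
      = tensor_lift (\<lambda>x y. blinfun_apply f x * blinfun_apply (g o\<^sub>L T) y) u"
    by (rule linear_tensor_ext[where \<phi> = "\<lambda>u. tensor_lift _ (tensor_map id T u)"])
      (auto intro!: linear_tensor_lift bilinear_functional_pair
        linear_compose[OF linear_map_right[OF T], unfolded o_def]
        simp: tensor_map_prod[OF linear_id T] tensor_lift_prod[OF bilinear_functional_pair]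
        simp del: blinfun_apply_blinfun_compose, simp)
  moreover have "norm (g o\<^sub>L T) \<le> 1"
    using norm_blinfun_compose[of g T] mult_mono[OF g assms] by simp
  ultimately show "\<bar>tensor_lift (\<lambda>x y. blinfun_apply f x * blinfun_apply g y) (tensor_map id T u)\<bar>
      \<le> inj_norm u"
    using functional_pair_le_inj_norm[OF f] by metis
qed

section \<open>Comparing the constants\<close>

lemma contraction_le_norm:
  fixes f :: "'a::real_normed_vector \<Rightarrow>\<^sub>L 'b::real_normed_vector"
  assumes "norm f \<le> 1"
  shows "norm (f x) \<le> norm x"
  using norm_blinfun[of f x] mult_right_mono[OF assms, of "norm x"] by simp

lemma contraction_pairing_le:
  fixes A :: "'a::real_normed_vector \<Rightarrow>\<^sub>L ('b::real_normed_vector \<Rightarrow>\<^sub>L real)"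
  assumes "norm A \<le> 1"
  shows "\<bar>blinfun_apply (blinfun_apply A x) y\<bar> \<le> norm x * norm y"
  using norm_blinfun[of "blinfun_apply A x" y]
    mult_right_mono[OF contraction_le_norm[OF assms, of x], of "norm y"]
  by simp

lemma bilinear_blinfun_pairing:
  "bilinear (\<lambda>x y. blinfun_apply (blinfun_apply A x) y)"
  unfolding bilinear_def by (auto intro!: linearI simp: blinfun.bilinear_simps)

lemma linear_blinfun: "linear (blinfun_apply T)"
  by (simp add: bounded_linear.linear blinfun.bounded_linear_right)

lemma inj_proj_opnorm_upper:
  "inj_norm u \<le> 1 \<Longrightarrow> ereal (proj_norm (T u)) \<le> inj_proj_opnorm T"
  unfolding inj_proj_opnorm_def by (rule SUP_upper) simp

lemma K_G_upper:
  fixes A :: "'a::banach \<Rightarrow>\<^sub>L ('a \<Rightarrow>\<^sub>L real)" and u :: "('a, 'b::banach) tensor"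
  assumes "norm A \<le> 1" "inj_norm u \<le> 1"
  shows "ereal (proj_norm (tensor_map (blinfun_apply A) id u)) \<le> K_G TYPE('a) TYPE('b)"
proof -
  have "inj_proj_opnorm (tensor_map (blinfun_apply A) (id :: 'b \<Rightarrow> 'b)) \<le> K_G TYPE('a) TYPE('b)"
    unfolding K_G_def by (rule SUP_upper) (use assms in simp)
  then show ?thesis
    using inj_proj_opnorm_upper[OF assms(2)] by (rule order_trans[rotated])
qed

lemma tensor_map_id:
  fixes u :: "('a::real_vector, 'b::real_vector) tensor"
  shows "tensor_map id id u = u"
proof (rule linear_tensor_ext[of "tensor_map id id" "\<lambda>u. u"])
  show "linear (tensor_map id id :: ('a, 'b) tensor \<Rightarrow> ('a, 'b) tensor)"
    by (rule linear_tensor_map[OF linear_id linear_id])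
  show "tensor_map id id (x \<otimes>\<^sub>t y) = x \<otimes>\<^sub>t y" for x :: 'a and y :: 'b
    by (simp add: tensor_map_prod[OF linear_id linear_id])
qed (rule linear_ident)

text \<open>For the norming functional \<open>\<phi>\<close> of \<open>(A \<otimes> id) u\<close>, reflexivity of the first space turns
  each functional \<open>h \<mapsto> \<phi> (h \<otimes> y)\<close> into a vector \<open>b y\<close>. This moves \<open>\<phi>\<close> from one side of the
  pairing to the other: \<open>\<phi> ((A \<otimes> id) u)\<close> is the bilinear form \<open>A\<close> evaluated at \<open>(id \<otimes> b) u\<close>.\<close>

lemma K_G_le_\<rho>:
  fixes fs :: "(('a::banach \<Rightarrow>\<^sub>L real) \<times> 'a) list"
  assumes fs: "frame fs UNIV"
  shows "K_G TYPE('a) TYPE('b::banach) \<le> \<rho> TYPE('a) TYPE('a)"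
  unfolding K_G_def inj_proj_opnorm_def[of "tensor_map _ _"]
proof (intro SUP_least)
  fix A :: "'a \<Rightarrow>\<^sub>L ('a \<Rightarrow>\<^sub>L real)" and u :: "('a, 'b) tensor"
  assume "A \<in> {A. norm A \<le> 1}" "u \<in> {u. inj_norm u \<le> 1}"
  then have A: "norm A \<le> 1" and u: "inj_norm u \<le> 1" by auto
  let ?Au = "tensor_map (blinfun_apply A) id u"
  obtain \<phi> where \<phi>: "linear \<phi>" "\<And>f y. \<bar>\<phi> (f \<otimes>\<^sub>t y)\<bar> \<le> norm f * norm y" "\<phi> ?Au = proj_norm ?Au"
    by (rule proj_norm_attained[of ?Au]) blast
  note simps = linear_add[OF \<phi>(1)] linear_scale[OF \<phi>(1)]
    bilinear_ladd[OF bilinear_tensor_prod] bilinear_radd[OF bilinear_tensor_prod]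
    bilinear_lmul[OF bilinear_tensor_prod] bilinear_rmul[OF bilinear_tensor_prod]
  define b where "b y = (\<Sum>(f, c)\<leftarrow>fs. \<phi> (f \<otimes>\<^sub>t y) *\<^sub>R c)" for y
  have eval: "blinfun_apply h (b y) = \<phi> (h \<otimes>\<^sub>t y)" for h y
    unfolding b_def by (rule frame_bidual_eval[OF fs]) (auto intro!: linearI simp: simps)
  \<comment> \<open>The embedding into the bidual is isometric, again by Hahn--Banach.\<close>
  have b_norm: "norm (b y) \<le> norm y" for y
  proof -
    obtain h :: "'a \<Rightarrow>\<^sub>L real" where h: "norm h \<le> 1" "h (b y) = norm (b y)"
      by (rule norming_functional)
    have "norm (b y) \<le> norm h * norm y"
      using \<phi>(2)[of h y] h(2) eval[of h y] by simp
    then show ?thesis using mult_right_mono[OF h(1), of "norm y"] by simp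
  qed
  have "bounded_linear b"
  proof (rule bounded_linear_intro[where K = 1])
    show "b (y + y') = b y + b y'" for y y'
      unfolding b_def by (induction fs) (auto simp: simps algebra_simps)
    show "b (t *\<^sub>R y) = t *\<^sub>R b y" for t y
      unfolding b_def by (induction fs) (auto simp: simps algebra_simps)
  qed (use b_norm in simp)
  then have B: "blinfun_apply (Blinfun b) = b" by (simp add: bounded_linear_Blinfun_apply)
  have B1: "norm (Blinfun b) \<le> 1"
    by (rule norm_blinfun_bound) (use b_norm in \<open>auto simp: B\<close>)
  have b: "linear b" using linear_blinfun[of "Blinfun b"] by (simp add: B)
  let ?w = "tensor_map id b u"
  let ?\<psi> = "tensor_lift (\<lambda>x y. blinfun_apply (blinfun_apply A x) y)"
  have "\<phi> ?Au = ?\<psi> ?w"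
    by (rule linear_tensor_ext[where \<phi> = "\<lambda>u. \<phi> (tensor_map _ _ u)" and \<psi> = "\<lambda>u. ?\<psi> (tensor_map _ _ u)"])
      (auto intro!: linear_compose[OF linear_tensor_map \<phi>(1), unfolded o_def] linear_blinfun linear_id
        linear_compose[OF linear_map_right[OF b] linear_tensor_lift, unfolded o_def]
        bilinear_blinfun_pairing
        simp: tensor_map_prod[OF linear_blinfun linear_id] tensor_map_prod[OF linear_id b]
        tensor_lift_prod[OF bilinear_blinfun_pairing] eval)
  also have "\<dots> \<le> \<bar>?\<psi> ?w\<bar>" by simp
  also have "\<dots> \<le> proj_norm ?w"
    by (rule contractive_le_proj_norm)
      (auto simp: linear_tensor_lift bilinear_blinfun_pairing
        tensor_lift_prod[OF bilinear_blinfun_pairing] contraction_pairing_le[OF A])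
  finally have "proj_norm ?Au \<le> proj_norm (tensor_map id id ?w)"
    by (simp add: \<phi>(3) tensor_map_id)
  moreover have "inj_norm ?w \<le> 1"
    using inj_norm_map_right[OF B1, of u] u by (simp add: B)
  ultimately show "ereal (proj_norm ?Au) \<le> \<rho> TYPE('a) TYPE('a)"
    unfolding \<rho>_def using inj_proj_opnorm_upper order_trans ereal_less_eq(3) by blast
qed

text \<open>The bilinear form that norms \<open>v\<close> factors as \<open>A \<otimes> id\<close> followed by the evaluation pairing,
  which is itself a bilinear form of norm at most 1.\<close>

lemma \<rho>_le_K_G_same: "\<rho> TYPE('a::banach) TYPE('a) \<le> K_G TYPE('a) TYPE('a)"
  unfolding \<rho>_def inj_proj_opnorm_def
proof (rule SUP_least)
  fix v :: "('a, 'a) tensor" assume "v \<in> {v. inj_norm v \<le> 1}"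
  then have v: "inj_norm v \<le> 1" by simp
  obtain \<phi> where \<phi>: "linear \<phi>" "\<And>x y. \<bar>\<phi> (x \<otimes>\<^sub>t y)\<bar> \<le> norm x * norm y" "\<phi> v = proj_norm v"
    by (rule proj_norm_attained[of v]) blast
  obtain A :: "'a \<Rightarrow>\<^sub>L ('a \<Rightarrow>\<^sub>L real)" where A: "norm A \<le> 1" "\<And>x y. A x y = \<phi> (x \<otimes>\<^sub>t y)"
    by (rule curry_functional[OF \<phi>(1,2)]) blast
  let ?Av = "tensor_map (blinfun_apply A) id v"
  let ?eval = "tensor_lift (\<lambda>(f :: 'a \<Rightarrow>\<^sub>L real) x. blinfun_apply f x)"
  have bil: "bilinear (\<lambda>(f :: 'a \<Rightarrow>\<^sub>L real) x. blinfun_apply f x)"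
    using bilinear_blinfun_pairing[of id_blinfun] by simp
  have "\<phi> v = (?eval \<circ> tensor_map (blinfun_apply A) id) v"
  proof (rule linear_tensor_ext[OF \<phi>(1)])
    show "linear (?eval \<circ> tensor_map (blinfun_apply A) (id :: 'a \<Rightarrow> 'a))"
      by (rule linear_compose[OF linear_tensor_map[OF linear_blinfun linear_id]
            linear_tensor_lift[OF bil]])
    show "\<phi> (x \<otimes>\<^sub>t y) = (?eval \<circ> tensor_map (blinfun_apply A) id) (x \<otimes>\<^sub>t y)" for x y
      by (simp add: tensor_map_prod[OF linear_blinfun linear_id] tensor_lift_prod[OF bil] A(2))
  qed
  also have "\<dots> = ?eval ?Av" by simp
  also have "\<dots> \<le> \<bar>?eval ?Av\<bar>" by simp
  also have "\<dots> \<le> proj_norm ?Av"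
  proof (rule contractive_le_proj_norm[OF linear_tensor_lift[OF bil]])
    show "\<bar>?eval (f \<otimes>\<^sub>t x)\<bar> \<le> norm f * norm x" for f x
      using norm_blinfun[of f x] by (simp add: tensor_lift_prod[OF bil])
  qed
  finally have "ereal (proj_norm v) \<le> ereal (proj_norm ?Av)" by (simp add: \<phi>(3))
  also have "\<dots> \<le> K_G TYPE('a) TYPE('a)" by (rule K_G_upper[OF A(1) v])
  finally show "ereal (proj_norm (tensor_map id id v)) \<le> K_G TYPE('a) TYPE('a)"
    by (simp add: tensor_map_id)
qed

text \<open>Homogeneity removes the restriction to the unit balls: a tensor in the injective unit ball
  is a bilinear form of norm at most 1 on the dual spaces.\<close>

lemma functional_pair_le:
  fixes u :: "('a::real_normed_vector, 'b::real_normed_vector) tensor"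
  assumes u: "inj_norm u \<le> 1"
  shows "\<bar>tensor_lift (\<lambda>x y. blinfun_apply f x * blinfun_apply g y) u\<bar> \<le> norm f * norm g"
proof -
  let ?L = "\<lambda>f g :: _ \<Rightarrow>\<^sub>L real. tensor_lift (\<lambda>x y. blinfun_apply f x * blinfun_apply g y) u"
  obtain ps where ps: "u = (\<Sum>(x, y)\<leftarrow>ps. x \<otimes>\<^sub>t y)" using tensor_list_rep by blast
  have L: "?L f g = (\<Sum>(x, y)\<leftarrow>ps. f x * g y)" for f g
    unfolding ps by (rule tensor_lift_list[OF bilinear_functional_pair])
  have scale: "?L (s *\<^sub>R f) (t *\<^sub>R g) = s * t * ?L f g" for s t
    unfolding L by (induction ps) (auto simp: blinfun.bilinear_simps algebra_simps)
  have "?L f g = norm f * norm g * ?L (sgn f) (sgn g)"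
    using scale[of "inverse (norm f)" "inverse (norm g)"] L
    by (cases "f = 0"; cases "g = 0") (auto simp: sgn_div_norm field_simps split_beta)
  moreover have "\<bar>?L (sgn f) (sgn g)\<bar> \<le> 1"
    by (rule order_trans[OF functional_pair_le_inj_norm u]) (auto simp: norm_sgn)
  ultimately show ?thesis
    by (simp add: abs_mult mult_left_le)
qed

text \<open>This tensor is the identity operator: pairing it with \<open>h\<close> and \<open>G\<close> gives \<open>G h\<close>, by the
  expansion of \<open>h\<close> in the frame.\<close>

lemma frame_tensor_inj_norm:
  fixes fs :: "(('a::real_normed_vector \<Rightarrow>\<^sub>L real) \<times> 'a) list"
  assumes fs: "frame fs UNIV"
  shows "inj_norm (\<Sum>(f, c)\<leftarrow>fs. c \<otimes>\<^sub>t f) \<le> 1"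
proof (rule inj_norm_least)
  fix h :: "'a \<Rightarrow>\<^sub>L real" and G :: "('a \<Rightarrow>\<^sub>L real) \<Rightarrow>\<^sub>L real"
  assume h: "norm h \<le> 1" and G: "norm G \<le> 1"
  let ?L = "tensor_lift (\<lambda>x y. blinfun_apply h x * blinfun_apply G y)"
  have lin: "linear ?L" by (rule linear_tensor_lift[OF bilinear_functional_pair])
  have "?L (\<Sum>(f, c)\<leftarrow>fs'. c \<otimes>\<^sub>t f) = G (\<Sum>(f, c)\<leftarrow>fs'. blinfun_apply h c *\<^sub>R f)"
    for fs' :: "(('a \<Rightarrow>\<^sub>L real) \<times> 'a) list"
    by (induction fs')
      (auto simp: linear_0[OF lin] linear_add[OF lin] blinfun.bilinear_simps
        tensor_lift_prod[OF bilinear_functional_pair])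
  then have "?L (\<Sum>(f, c)\<leftarrow>fs. c \<otimes>\<^sub>t f) = G h"
    using frame_dual[OF fs, of h] by metis
  then show "\<bar>?L (\<Sum>(f, c)\<leftarrow>fs. c \<otimes>\<^sub>t f)\<bar> \<le> 1"
    using contraction_le_norm[OF G, of h] h by simp
qed

text \<open>With \<open>u\<close> the tensor of the identity and \<open>\<beta>\<close> the bilinear form of \<open>v\<close> on pairs of
  functionals, the value of \<open>\<beta>\<close> on \<open>(A \<otimes> id) u\<close> is a double sum over the frame and over
  \<open>v\<close>. Summing over the frame first reproduces each left factor of \<open>v\<close>, and what remains is the
  value at \<open>v\<close> of the functional that norms \<open>v\<close>.\<close>

lemma \<rho>_le_K_G_dual:
  fixes fs :: "(('a::banach \<Rightarrow>\<^sub>L real) \<times> 'a) list"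
  assumes fs: "frame fs UNIV"
  shows "\<rho> TYPE('a) TYPE('a) \<le> K_G TYPE('a) TYPE('a \<Rightarrow>\<^sub>L real)"
  unfolding \<rho>_def inj_proj_opnorm_def
proof (rule SUP_least)
  fix v :: "('a, 'a) tensor" assume "v \<in> {v. inj_norm v \<le> 1}"
  then have v: "inj_norm v \<le> 1" by simp
  obtain \<phi> where \<phi>: "linear \<phi>" "\<And>x y. \<bar>\<phi> (x \<otimes>\<^sub>t y)\<bar> \<le> norm x * norm y" "\<phi> v = proj_norm v"
    by (rule proj_norm_attained[of v]) blast
  obtain A :: "'a \<Rightarrow>\<^sub>L ('a \<Rightarrow>\<^sub>L real)" where A: "norm A \<le> 1" "\<And>x y. A x y = \<phi> (x \<otimes>\<^sub>t y)"
    by (rule curry_functional[OF \<phi>(1,2)]) blast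
  obtain ps where ps: "v = (\<Sum>(x, y)\<leftarrow>ps. x \<otimes>\<^sub>t y)" using tensor_list_rep by blast
  let ?u = "\<Sum>(f, c)\<leftarrow>fs. c \<otimes>\<^sub>t f"
  let ?Au = "tensor_map (blinfun_apply A) id ?u"
  \<comment> \<open>The factors are swapped: the first argument of \<open>\<beta>\<close>, which receives \<open>A c\<close>, meets the second
    factor of \<open>v\<close>, as \<open>A x y\<close> requires.\<close>
  define \<beta> where "\<beta> g f = tensor_lift (\<lambda>x y. blinfun_apply f x * blinfun_apply g y) v"
    for g f :: "'a \<Rightarrow>\<^sub>L real"
  have \<beta>: "\<beta> g f = (\<Sum>(x, y)\<leftarrow>ps. f x * g y)" for g f
    unfolding \<beta>_def ps by (rule tensor_lift_list[OF bilinear_functional_pair])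
  have bil: "bilinear \<beta>"
    unfolding bilinear_def \<beta>
    by (intro conjI allI linearI; induction ps) (auto simp: blinfun.bilinear_simps algebra_simps)
  let ?T = "tensor_lift \<beta> \<circ> tensor_map (blinfun_apply A) (id :: ('a \<Rightarrow>\<^sub>L real) \<Rightarrow> 'a \<Rightarrow>\<^sub>L real)"
  have lin: "linear ?T"
    by (rule linear_compose[OF linear_tensor_map[OF linear_blinfun linear_id]
          linear_tensor_lift[OF bil]])
  have "?T (\<Sum>(f, c)\<leftarrow>fs'. c \<otimes>\<^sub>t f)
      = (\<Sum>(f, c)\<leftarrow>fs'. \<beta> (A c) f)"
    for fs' :: "(('a \<Rightarrow>\<^sub>L real) \<times> 'a) list"
  proof (induction fs')
    case Nil
    show ?case by (simp only: list.map sum_list.Nil linear_0[OF lin])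
  next
    case (Cons p fs')
    obtain f c where p: "p = (f, c)" by (cases p)
    have "?T (c \<otimes>\<^sub>t f) = \<beta> (A c) f"
      by (simp add: tensor_map_prod[OF linear_blinfun linear_id] tensor_lift_prod[OF bil])
    with Cons show ?case
      by (simp only: p list.map sum_list.Cons prod.case linear_add[OF lin])
  qed
  \<comment> \<open>Interchange of the two summations.\<close>
  also have "(\<Sum>(f, c)\<leftarrow>fs'. \<beta> (A c) f)
      = (\<Sum>(x, y)\<leftarrow>ps. A (\<Sum>(f, c)\<leftarrow>fs'. blinfun_apply f x *\<^sub>R c) y)"
    for fs' :: "(('a \<Rightarrow>\<^sub>L real) \<times> 'a) list"
  proof (induction fs')
    case Nil
    show ?case by (induction ps) (auto simp: blinfun.bilinear_simps)
  next
    case (Cons p fs')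
    obtain f c where p: "p = (f, c)" by (cases p)
    have "(\<Sum>(x, y)\<leftarrow>ps. A (\<Sum>(f, c)\<leftarrow>p # fs'. blinfun_apply f x *\<^sub>R c) y)
      = \<beta> (A c) f + (\<Sum>(x, y)\<leftarrow>ps. A (\<Sum>(f, c)\<leftarrow>fs'. blinfun_apply f x *\<^sub>R c) y)"
      unfolding \<beta> p by (induction ps) (auto simp: blinfun.bilinear_simps)
    with Cons show ?case by (simp add: p)
  qed
  finally have "?T ?u
      = (\<Sum>(x, y)\<leftarrow>ps. A (\<Sum>(f, c)\<leftarrow>fs. blinfun_apply f x *\<^sub>R c) y)" .
  also have "\<dots> = (\<Sum>(x, y)\<leftarrow>ps. A x y)"
    using fs by (simp add: frame_def)
  also have "\<dots> = \<phi> v"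
    by (simp add: ps linear_tensor_list[OF \<phi>(1)] A(2))
  finally have "proj_norm v = tensor_lift \<beta> ?Au" by (simp add: \<phi>(3))
  also have "\<dots> \<le> \<bar>tensor_lift \<beta> ?Au\<bar>" by simp
  also have "\<dots> \<le> proj_norm ?Au"
  proof (rule contractive_le_proj_norm[OF linear_tensor_lift[OF bil]])
    show "\<bar>tensor_lift \<beta> (g \<otimes>\<^sub>t f)\<bar> \<le> norm g * norm f" for g f
      using functional_pair_le[OF v, of f g]
      by (simp add: tensor_lift_prod[OF bil] \<beta>_def mult.commute)
  qed
  finally have "ereal (proj_norm v) \<le> ereal (proj_norm ?Au)" by simp
  also have "\<dots> \<le> K_G TYPE('a) TYPE('a \<Rightarrow>\<^sub>L real)"
    by (rule K_G_upper[OF A(1) frame_tensor_inj_norm[OF fs]])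
  finally show "ereal (proj_norm (tensor_map id id v)) \<le> K_G TYPE('a) TYPE('a \<Rightarrow>\<^sub>L real)"
    by (simp add: tensor_map_id)
qed

theorem lemma4p4:
  assumes "\<exists>B :: 'a::banach set. finite B \<and> span B = UNIV"
  shows "K_G TYPE('a) TYPE('a \<Rightarrow>\<^sub>L real) = K_G TYPE('a) TYPE('a)
    \<and> K_G TYPE('a) TYPE('a) = \<rho> TYPE('a) TYPE('a)"
proof -
  obtain fs :: "(('a \<Rightarrow>\<^sub>L real) \<times> 'a) list" where fs: "frame fs UNIV"
    using assms exists_frame by metis
  have "K_G TYPE('a) TYPE('a) = \<rho> TYPE('a) TYPE('a)"
    by (rule antisym[OF K_G_le_\<rho>[OF fs] \<rho>_le_K_G_same])
  moreover have "K_G TYPE('a) TYPE('a \<Rightarrow>\<^sub>L real) = \<rho> TYPE('a) TYPE('a)"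
    by (rule antisym[OF K_G_le_\<rho>[OF fs] \<rho>_le_K_G_dual[OF fs]])
  ultimately show ?thesis by simp
qed

end
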